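(* Let $n \geq 4$ be an integer. Then the square $Q_n^2$ of the hypercube $Q_n$ is a distance-transitive graph.
   Context: All graphs are finite, simple and undirected. The hypercube $Q_n$ is the graph with vertex set $\{0,1\}^n$ in which two $n$-tuples are adjacent if and only if they differ in precisely one coordinate. For a graph $\Gamma=(V,E)$, the square $\Gamma^2$ is the simple graph with vertex set $V$ in which two distinct vertices are adjacent if and only if their distance in $\Gamma$ is at most two. A graph $\Gamma$ is distance-transitive if for all vertices $u,v,x,y$ of $\Gamma$ such that $d(u,v)=d(x,y)$, where $d$ is the graph distance in $\Gamma$, there is an automorphism $\pi$ of $\Gamma$ such that $\pi(u)=x$ and $\pi(v)=y$. *)

theory Defs
  imports "Graph_Theory.Graph_Theory"
begin

text \<open>
  A finite simple undirected graph is a \<open>pair_graph\<close>: finitely many vertices and a symmetric,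
  irreflexive set of arcs, an edge being the two arcs between its endpoints.
  The distance is the cost of a cheapest walk when every arc costs 1 (infinite if there is no walk).
\<close>

definition gdist :: "'a pair_pre_digraph \<Rightarrow> 'a \<Rightarrow> 'a \<Rightarrow> ereal" where
  "gdist G u v = wf_digraph.\<mu> (with_proj G) (\<lambda>_. 1) u v"

lemma gdist_eq_INF_length:
  assumes "pair_graph G"
  shows "gdist G u v = (INF p\<in>{p. pre_digraph.awalk (with_proj G) u p v}. ereal (real (length p)))"
proof -
  interpret pair_graph G by fact
  have eq: "awalk_cost (\<lambda>_. 1) p = real (length p)" for p :: "('a \<times> 'a) awalk"
    by (induction p)
      (simp_all only: awalk_cost_Nil awalk_cost_Cons list.size of_nat_0 of_nat_Suc add.commute
        add_0 One_nat_def plus_1_eq_Suc)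
  show ?thesis unfolding gdist_def \<mu>_def eq by (rule refl)
qed

definition square :: "'a pair_pre_digraph \<Rightarrow> 'a pair_pre_digraph" where
  "square G =
    \<lparr> pverts = pverts G,
      parcs = {(u, v). u \<in> pverts G \<and> v \<in> pverts G \<and> u \<noteq> v \<and> gdist G u v \<le> 2} \<rparr>"

text \<open>
  In \<open>app_iso h G = G\<close> the tail and head maps of \<open>h\<close> are forced to be \<open>fst\<close> and \<open>snd\<close>, so the
  action of \<open>h\<close> on arcs is determined by its action \<open>f\<close> on vertices. Values of \<open>f\<close> outside the
  vertex set are irrelevant.
\<close>

definition automorphism :: "'a pair_pre_digraph \<Rightarrow> ('a \<Rightarrow> 'a) \<Rightarrow> bool" where
  "automorphism G f \<longleftrightarrow>
    (\<exists>h. pre_digraph.digraph_isomorphism (with_proj G) h \<and>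
         app_iso h (with_proj G) = with_proj G \<and> iso_verts h = f)"

definition distance_transitive :: "'a pair_pre_digraph \<Rightarrow> bool" where
  "distance_transitive G \<longleftrightarrow>
    pair_graph G \<and>
    (\<forall>u\<in>pverts G. \<forall>v\<in>pverts G. \<forall>x\<in>pverts G. \<forall>y\<in>pverts G.
      gdist G u v = gdist G x y \<longrightarrow> (\<exists>f. automorphism G f \<and> f u = x \<and> f v = y))"

definition hypercube :: "nat \<Rightarrow> bool list pair_pre_digraph" where
  "hypercube n =
    \<lparr> pverts = {x. length x = n},
      parcs = {(x, y). length x = n \<and> length y = n \<and> card {i. i < n \<and> x ! i \<noteq> y ! i} = 1} \<rparr>"

lemma automorphism_iff:
  assumes "pair_graph G"
  shows "automorphism G f \<longleftrightarrow>
    bij_betw f (pverts G) (pverts G) \<and>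
    (\<forall>u\<in>pverts G. \<forall>v\<in>pverts G. (u, v) \<in> parcs G \<longleftrightarrow> (f u, f v) \<in> parcs G)"
    (is "?L \<longleftrightarrow> ?R")
proof -
  interpret pair_graph G by fact
  show ?thesis
  proof
    assume ?L
    then obtain h where h: "digraph_isomorphism h"
      "app_iso h (with_proj G) = with_proj G" "iso_verts h = f"
      unfolding automorphism_def by blast
    have ht: "iso_tail h = fst" "iso_head h = snd"
      and V: "f ` pverts G = pverts G" and A: "iso_arcs h ` parcs G = parcs G"
      using h(2,3) by (auto simp: app_iso_def with_proj_def)
    have inj: "inj_on f (pverts G)"
      using h(1,3) by (auto simp: digraph_isomorphism_def)
    have arc: "iso_arcs h e = (f (fst e), f (snd e))" if "e \<in> parcs G" for e
      using h(1,3) ht that by (auto simp: digraph_isomorphism_def intro: prod_eqI)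
    have "(u, v) \<in> parcs G \<longleftrightarrow> (f u, f v) \<in> parcs G" if uv: "u \<in> pverts G" "v \<in> pverts G" for u v
    proof
      assume "(u, v) \<in> parcs G"
      then show "(f u, f v) \<in> parcs G" using A arc[of "(u, v)"] by force
    next
      assume "(f u, f v) \<in> parcs G"
      then obtain e where e: "e \<in> parcs G" "(f u, f v) = iso_arcs h e" using A by blast
      then have "f u = f (fst e)" "f v = f (snd e)" using arc by auto
      moreover have "fst e \<in> pverts G" "snd e \<in> pverts G"
        using e(1) arc_fst_in_verts arc_snd_in_verts by auto
      ultimately have "u = fst e" "v = snd e" using inj uv by (auto dest: inj_onD)
      then show "(u, v) \<in> parcs G" using e(1) by simp
    qed
    with inj V show ?R by (simp add: bij_betw_def)
  next
    assume R: ?R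
    define h where "h = \<lparr> iso_verts = f, iso_arcs = map_prod f f,
      iso_head = (snd :: 'a \<times> 'a \<Rightarrow> 'a), iso_tail = (fst :: 'a \<times> 'a \<Rightarrow> 'a) \<rparr>"
    have inj: "inj_on f (pverts G)" and V: "f ` pverts G = pverts G"
      using R by (auto simp: bij_betw_def)
    have sub: "parcs G \<subseteq> pverts G \<times> pverts G"
      by (rule subrelI) (simp add: in_arcsD1 in_arcsD2)
    have injA: "inj_on (map_prod f f) (parcs G)"
      using inj_on_subset[OF map_prod_inj_on[OF inj inj] sub] .
    have "map_prod f f ` parcs G = parcs G"
    proof
      show "map_prod f f ` parcs G \<subseteq> parcs G" using R sub by auto
      show "parcs G \<subseteq> map_prod f f ` parcs G"
      proof
        fix e assume e: "e \<in> parcs G"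
        obtain a b where ab: "e = (a, b)" by (cases e)
        with e sub have "a \<in> f ` pverts G" "b \<in> f ` pverts G" using V by auto
        then obtain u v where "u \<in> pverts G" "v \<in> pverts G" "a = f u" "b = f v" by blast
        with R e ab show "e \<in> map_prod f f ` parcs G" by force
      qed
    qed
    with V have "app_iso h (with_proj G) = with_proj G"
      by (simp add: app_iso_def with_proj_def h_def)
    moreover have "digraph_isomorphism h"
      using inj injA wf_digraph by (auto simp: digraph_isomorphism_def h_def)
    ultimately show ?L by (auto simp: automorphism_def h_def)
  qed
qed

lemma pair_graph_hypercube: "pair_graph (hypercube n)"
proof -
  let ?V = "{x :: bool list. length x = n}"
  have verts: "pverts (hypercube n) = ?V" by (simp only: hypercube_def pair_pre_digraph.simps)
  have arcD: "x \<in> ?V \<and> y \<in> ?V \<and> card {i. i < n \<and> x ! i \<noteq> y ! i} = 1"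
    if "(x, y) \<in> parcs (hypercube n)" for x y
    using that unfolding hypercube_def pair_pre_digraph.simps mem_Collect_eq case_prod_conv .
  have arcI: "(x, y) \<in> parcs (hypercube n)"
    if "x \<in> ?V \<and> y \<in> ?V \<and> card {i. i < n \<and> x ! i \<noteq> y ! i} = 1" for x y
    using that unfolding hypercube_def pair_pre_digraph.simps mem_Collect_eq case_prod_conv .
  have sub: "parcs (hypercube n) \<subseteq> ?V \<times> ?V"
  proof (rule subrelI)
    fix x y assume "(x, y) \<in> parcs (hypercube n)"
    from arcD[OF this] show "(x, y) \<in> ?V \<times> ?V" by blast
  qed
  have fin: "finite ?V"
    using finite_lists_length_eq[of "UNIV :: bool set" n] by simp
  have sym: "(y, x) \<in> parcs (hypercube n)" if xy: "(x, y) \<in> parcs (hypercube n)" for x y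
  proof -
    have "{i. i < n \<and> y ! i \<noteq> x ! i} = {i. i < n \<and> x ! i \<noteq> y ! i}" by blast
    then have "card {i. i < n \<and> y ! i \<noteq> x ! i} = 1" using arcD[OF xy] by (simp only:)
    then show ?thesis using arcD[OF xy] by (intro arcI) blast
  qed
  show ?thesis
  proof unfold_locales
    show "finite (pverts (hypercube n))" using fin by (simp only: verts)
    show "finite (parcs (hypercube n))"
      by (rule finite_subset[OF sub]) (rule finite_cartesian_product[OF fin fin])
    show "symmetric (with_proj (hypercube n))"
      unfolding symmetric_def with_proj_simps by (rule symI) (rule sym)
    fix e assume e: "e \<in> parcs (hypercube n)"
    then have "e \<in> ?V \<times> ?V" using sub by blast
    then show "fst e \<in> pverts (hypercube n)" "snd e \<in> pverts (hypercube n)"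
      unfolding verts by (simp_all only: mem_Times_iff)
    show "fst e \<noteq> snd e"
    proof
      assume "fst e = snd e"
      with e have "(fst e, fst e) \<in> parcs (hypercube n)" by (cases e) simp
      from arcD[OF this] show False by simp
    qed
  qed
qed

lemma gdist_commute:
  assumes "pair_graph G"
  shows "gdist G u v = gdist G v u"
proof -
  interpret pair_graph G by fact
  have rev: "\<exists>q. awalk v q u \<and> length q = length p" if "awalk u p v" for u p v
    using that
  proof (induction p arbitrary: u)
    case Nil
    then show ?case by (auto simp: awalk_def)
  next
    case (Cons e p)
    then have e: "e \<in> parcs G" "u = fst e" and p: "awalk (snd e) p v"
      by (auto simp: awalk_Cons_iff)
    from Cons.IH[OF p] obtain q where q: "awalk v q (snd e)" "length q = length p" by blast
    have "(snd e, fst e) \<in> parcs G"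
      using e(1) pair_sym_arcs by (cases e) (auto simp: symmetric_def dest: symD)
    then have "awalk (snd e) [(snd e, fst e)] u"
      using e by (auto simp: awalk_def intro: wellformed')
    with q(1) have "awalk v (q @ [(snd e, fst e)]) u" by (rule awalk_appendI)
    with q(2) show ?case by (intro exI[of _ "q @ [(snd e, fst e)]"]) simp
  qed
  have "length ` {p. awalk u p v} \<subseteq> length ` {p. awalk v p u}" for u v
  proof
    fix k assume "k \<in> length ` {p. awalk u p v}"
    then obtain p where "awalk u p v" "k = length p" by blast
    with rev obtain q where "awalk v q u" "length q = k" by blast
    then show "k \<in> length ` {p. awalk v p u}" by blast
  qed
  then have "length ` {p. awalk u p v} = length ` {p. awalk v p u}" by blast
  then have "(\<lambda>k. ereal (real k)) ` length ` {p. awalk u p v} =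
      (\<lambda>k. ereal (real k)) ` length ` {p. awalk v p u}" by simp
  then show ?thesis
    unfolding gdist_eq_INF_length[OF assms] by (simp add: image_image)
qed

lemma pair_graph_square:
  assumes "pair_graph G"
  shows "pair_graph (square G)"
proof -
  interpret pair_graph G by fact
  show ?thesis
  proof unfold_locales
    show "finite (pverts (square G))" by (simp add: square_def)
    have "parcs (square G) \<subseteq> pverts G \<times> pverts G" by (auto simp: square_def)
    then show "finite (parcs (square G))" by (rule finite_subset) simp
    show "symmetric (with_proj (square G))"
      by (auto simp: symmetric_def sym_def square_def gdist_commute[OF assms])
  qed (auto simp: square_def)
qed

end

(* Appending a parity bit to every word identifies the vertices of the square of Q_n with the
   even-sized subsets of {..n}, two of them being adjacent iff their symmetric difference has
   exactly two elements (the halved (n+1)-cube). The distance in the square is half the size of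
   the symmetric difference, and the maps X \<mapsto> \<pi>(X + U) + X', with \<pi> a permutation of {..n} and
   + the symmetric difference, are automorphisms; they act transitively on pairs at given
   distance because a permutation can map any set to any other set of the same size. *)

theory Submission
  imports Defs
begin

section \<open>Computing graph distances from a potential function\<close>

text \<open>The target \<open>v\<close> is fixed and \<open>d a v\<close> acts as a potential. An
  arc lowers it by at most one, so every walk to \<open>v\<close> has length at least its initial
  value. Conversely, from any vertex of positive potential some arc lowers it by exactly one, and
  following such arcs reaches \<open>v\<close> after \<open>d u v\<close> steps.\<close>

lemma gdist_eqI:
  fixes d :: "'a \<Rightarrow> 'a \<Rightarrow> nat"
  assumes G: "pair_graph G" and u: "u \<in> pverts G" and v: "v \<in> pverts G"
    and refl: "d v v = 0"
    and arc: "\<And>a b. (a, b) \<in> parcs G \<Longrightarrow> d a v \<le> Suc (d b v)"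
    and zero: "\<And>a. a \<in> pverts G \<Longrightarrow> d a v = 0 \<Longrightarrow> a = v"
    and step: "\<And>a. a \<in> pverts G \<Longrightarrow> 0 < d a v \<Longrightarrow> \<exists>b. (a, b) \<in> parcs G \<and> d a v = Suc (d b v)"
  shows "gdist G u v = ereal (real (d u v))"
proof -
  interpret pair_graph G by fact
  have lower: "d a v \<le> length p" if "awalk a p v" for a p
    using that
  proof (induction p arbitrary: a)
    case Nil
    then show ?case using refl by (auto simp: awalk_def)
  next
    case (Cons e p)
    then have "(a, snd e) \<in> parcs G" "d (snd e) v \<le> length p"
      by (auto simp: awalk_Cons_iff)
    then show ?case using arc[of a "snd e"] by simp
  qed
  have upper: "\<exists>p. awalk a p v \<and> length p = d a v" if "a \<in> pverts G" for a
    using that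
  proof (induction "d a v" arbitrary: a)
    case 0
    then have "a = v" using zero by simp
    then show ?case using refl v by (intro exI[of _ "[]"]) (simp add: awalk_Nil_iff)
  next
    case (Suc k)
    then obtain b where b: "(a, b) \<in> parcs G" "d a v = Suc (d b v)"
      using step[of a] by auto
    then have "b \<in> pverts G" using in_arcsD2 by blast
    with Suc b obtain p where "awalk b p v" "length p = d b v" by auto
    with b show ?case by (intro exI[of _ "(a, b) # p"]) (auto simp: awalk_Cons_iff)
  qed
  from upper[OF u] obtain p where p: "awalk u p v" "length p = d u v" by blast
  show ?thesis unfolding gdist_eq_INF_length[OF G]
  proof (rule antisym)
    show "(INF p\<in>{p. awalk u p v}. ereal (real (length p))) \<le> ereal (real (d u v))"
      using p by (intro INF_lower2[of p]) auto
    show "ereal (real (d u v)) \<le> (INF p\<in>{p. awalk u p v}. ereal (real (length p)))"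
      using lower by (intro INF_greatest) auto
  qed
qed

section \<open>Symmetric differences and permutations of a finite set\<close>

lemma card_sym_diff:
  assumes "finite A" "finite B"
  shows "card (sym_diff A B) + 2 * card (A \<inter> B) = card A + card B"
proof -
  have "card (sym_diff A B) = card (A - B) + card (B - A)"
    using assms by (intro card_Un_disjoint) auto
  moreover have "card A = card (A \<inter> B) + card (A - B)" "card B = card (A \<inter> B) + card (B - A)"
    using assms card_Int_Diff[of A B] card_Int_Diff[of B A] by (auto simp: Int_commute)
  ultimately show ?thesis by simp
qed

lemma even_card_sym_diff:
  assumes "finite A" "finite B"
  shows "even (card (sym_diff A B)) \<longleftrightarrow> (even (card A) \<longleftrightarrow> even (card B))"
  using card_sym_diff[OF assms] by presburger

text \<open>Since \<open>S\<close> is finite, the complements of \<open>A\<close> and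
  \<open>B\<close> also have equal size; a bijection between the sets and one between the
  complements are glued together.\<close>

lemma permutation_mapping_subset:
  assumes "finite S" "A \<subseteq> S" "B \<subseteq> S" "card A = card B"
  obtains p where "bij_betw p S S" "p ` A = B"
proof -
  have fin: "finite A" "finite B" "finite (S - A)" "finite (S - B)"
    using assms by (auto intro: finite_subset)
  obtain f where f: "bij_betw f A B"
    using finite_same_card_bij[OF fin(1,2) assms(4)] by blast
  have "card (S - A) = card (S - B)"
    using assms fin by (simp add: card_Diff_subset)
  then obtain g where g: "bij_betw g (S - A) (S - B)"
    using finite_same_card_bij[OF fin(3,4)] by blast
  let ?p = "\<lambda>x. if x \<in> A then f x else g x"
  have "bij_betw ?p A B" by (subst bij_betw_cong[of _ _ f]) (simp_all add: f)
  moreover have "bij_betw ?p (S - A) (S - B)" by (subst bij_betw_cong[of _ _ g]) (simp_all add: g)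
  ultimately have "bij_betw ?p (A \<union> (S - A)) (B \<union> (S - B))"
    by (rule bij_betw_combine) auto
  moreover have "A \<union> (S - A) = S" "B \<union> (S - B) = S" using assms by auto
  moreover have "?p ` A = B" using f by (simp add: bij_betw_def)
  ultimately show ?thesis using that[of ?p] by simp
qed

section \<open>Words as sets and the Hamming distance\<close>

text \<open>Supports of words of length n lie in \<open>{..<n}\<close>, which leaves the element n
  free to serve as a parity bit.\<close>

definition support :: "bool list \<Rightarrow> nat set" where
  "support x = {i. i < length x \<and> x ! i}"

definition word :: "nat \<Rightarrow> nat set \<Rightarrow> bool list" where
  "word n A = map (\<lambda>i. i \<in> A) [0..<n]"

lemma length_word [simp]: "length (word n A) = n"
  by (simp add: word_def)

lemma support_word: "A \<subseteq> {..<n} \<Longrightarrow> support (word n A) = A"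
  by (auto simp: support_def word_def)

lemma support_subset: "length x = n \<Longrightarrow> support x \<subseteq> {..<n}"
  by (auto simp: support_def)

lemma finite_support [simp]: "finite (support x)"
  by (simp add: support_def)

lemma support_inject:
  assumes "length x = length y" "support x = support y"
  shows "x = y"
proof (rule nth_equalityI)
  show "x ! i = y ! i" if "i < length x" for i
  proof -
    have "i \<in> support x \<longleftrightarrow> i \<in> support y" using assms(2) by simp
    then show ?thesis using that assms(1) by (simp add: support_def)
  qed
qed (fact assms(1))

definition hamming :: "bool list \<Rightarrow> bool list \<Rightarrow> nat" where
  "hamming x y = card (sym_diff (support x) (support y))"

lemma hamming_eq_0_iff: "length x = length y \<Longrightarrow> hamming x y = 0 \<longleftrightarrow> x = y"
  using support_inject by (fastforce simp: hamming_def)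

lemma hamming_triangle: "hamming x z \<le> hamming x y + hamming y z"
proof -
  have "hamming x z \<le>
      card (sym_diff (support x) (support y) \<union> sym_diff (support y) (support z))"
    unfolding hamming_def by (rule card_mono) auto
  also have "\<dots> \<le> hamming x y + hamming y z"
    unfolding hamming_def by (rule card_Un_le)
  finally show ?thesis .
qed

text \<open>Flip in \<open>x\<close> any \<open>k\<close> of the coordinates where \<open>x\<close>
  and \<open>y\<close> differ. This supplies the descending arcs for both the cube and its
  square.\<close>

lemma hamming_between:
  assumes "length x = n" "length y = n" "k \<le> hamming x y"
  obtains z where "length z = n" "hamming x z = k" "hamming x y = k + hamming z y"
proof -
  let ?D = "sym_diff (support x) (support y)"
  obtain T where T: "T \<subseteq> ?D" "card T = k" "finite T"
    using obtain_subset_with_card_n[OF assms(3)[unfolded hamming_def]] by blast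
  have "sym_diff (support x) T \<subseteq> {..<n}"
    using T(1) support_subset[OF assms(1)] support_subset[OF assms(2)] by blast
  then have z: "support (word n (sym_diff (support x) T)) = sym_diff (support x) T"
    by (rule support_word)
  have "sym_diff (support x) (sym_diff (support x) T) = T" by auto
  then have "hamming x (word n (sym_diff (support x) T)) = k"
    using T(2) by (simp only: hamming_def z)
  moreover have "sym_diff (sym_diff (support x) T) (support y) = ?D - T" using T(1) by auto
  then have "hamming (word n (sym_diff (support x) T)) y = hamming x y - k"
    using T by (simp only: hamming_def z card_Diff_subset)
  ultimately show ?thesis using assms(3) that[of "word n (sym_diff (support x) T)"] by simp
qed

section \<open>Distances in the cube and in its square\<close>

lemma pverts_hypercube [simp]: "pverts (hypercube n) = {x. length x = n}"
  by (simp add: hypercube_def)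

lemma parcs_hypercube_iff:
  "(x, y) \<in> parcs (hypercube n) \<longleftrightarrow> length x = n \<and> length y = n \<and> hamming x y = 1"
proof -
  have "card {i. i < n \<and> x ! i \<noteq> y ! i} = hamming x y" if "length x = n" "length y = n"
    unfolding hamming_def using that by (intro arg_cong[where f = card]) (auto simp: support_def)
  then show ?thesis unfolding hypercube_def by (simp cong: conj_cong)
qed

lemma gdist_hypercube:
  assumes "length u = n" "length v = n"
  shows "gdist (hypercube n) u v = ereal (real (hamming u v))"
proof (rule gdist_eqI[OF pair_graph_hypercube])
  show "hamming a v \<le> Suc (hamming b v)" if "(a, b) \<in> parcs (hypercube n)" for a b
    using that hamming_triangle[of a v b] by (simp add: parcs_hypercube_iff)
  show "\<exists>b. (a, b) \<in> parcs (hypercube n) \<and> hamming a v = Suc (hamming b v)"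
    if "a \<in> pverts (hypercube n)" "0 < hamming a v" for a
  proof -
    have "length a = n" "1 \<le> hamming a v" using that by simp_all
    then obtain b where "length b = n" "hamming a b = 1" "hamming a v = 1 + hamming b v"
      using hamming_between[of a n v 1] assms(2) by blast
    with \<open>length a = n\<close> show ?thesis by (intro exI[of _ b]) (simp add: parcs_hypercube_iff)
  qed
qed (use assms hamming_eq_0_iff in auto)

lemma pverts_square_hypercube [simp]: "pverts (square (hypercube n)) = {x. length x = n}"
  by (simp add: square_def)

lemma parcs_square_hypercube_iff:
  "(x, y) \<in> parcs (square (hypercube n)) \<longleftrightarrow>
    length x = n \<and> length y = n \<and> 0 < hamming x y \<and> hamming x y \<le> 2"
proof -
  have "gdist (hypercube n) x y \<le> 2 \<longleftrightarrow> hamming x y \<le> 2"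
    if "length x = n" "length y = n"
  proof -
    have "(2 :: ereal) = ereal 2" by simp
    then show ?thesis unfolding gdist_hypercube[OF that] by (simp only: ereal_less_eq) simp
  qed
  then show ?thesis using hamming_eq_0_iff[of x y] by (auto simp: square_def)
qed

text \<open>An arc of the square changes one or two coordinates, so the distance is half the Hamming
  distance, rounded up.\<close>

lemma gdist_square_hypercube:
  assumes "length u = n" "length v = n"
  shows "gdist (square (hypercube n)) u v = ereal (real ((hamming u v + 1) div 2))"
proof (rule gdist_eqI[OF pair_graph_square[OF pair_graph_hypercube]])
  show "(hamming a v + 1) div 2 \<le> Suc ((hamming b v + 1) div 2)"
    if "(a, b) \<in> parcs (square (hypercube n))" for a b
  proof -
    have "hamming a v \<le> hamming b v + 2"
      using that hamming_triangle[of a v b] by (simp add: parcs_square_hypercube_iff)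
    then show ?thesis by presburger
  qed
  show "\<exists>b. (a, b) \<in> parcs (square (hypercube n)) \<and>
      (hamming a v + 1) div 2 = Suc ((hamming b v + 1) div 2)"
    if a: "a \<in> pverts (square (hypercube n))" "0 < (hamming a v + 1) div 2" for a
  proof -
    have pos: "0 < hamming a v" using a(2) by presburger
    \<comment> \<open>Flip two differing coordinates, or the only one if there is just one. The last
      condition makes the rounded half drop by exactly one.\<close>
    obtain k where k: "0 < k" "k \<le> 2" "k \<le> hamming a v" "k = 2 \<or> hamming a v = k"
    proof (cases "hamming a v = 1")
      case True
      then show ?thesis using that[of 1] by simp
    next
      case False
      then show ?thesis using pos that[of 2] by simp
    qed
    obtain z where z: "length z = n" "hamming a z = k" "hamming a v = k + hamming z v"
      using hamming_between[of a n v k] a(1) assms(2) k(3) by auto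
    have "(hamming a v + 1) div 2 = Suc ((hamming z v + 1) div 2)"
      using z(3) k by presburger
    with a z k show ?thesis by (intro exI[of _ z]) (simp add: parcs_square_hypercube_iff)
  qed
  show "a = v" if "a \<in> pverts (square (hypercube n))" "(hamming a v + 1) div 2 = 0" for a
  proof -
    have "hamming a v = 0" using that(2) by presburger
    with that(1) assms(2) show ?thesis by (simp add: hamming_eq_0_iff)
  qed
qed (use assms hamming_eq_0_iff in auto)

section \<open>The parity code and the halved cube\<close>

definition even_subsets :: "nat \<Rightarrow> nat set set" where
  "even_subsets n = {A. A \<subseteq> {..n} \<and> even (card A)}"

definition parity_code :: "nat \<Rightarrow> bool list \<Rightarrow> nat set" where
  "parity_code n x = (if even (card (support x)) then support x else insert n (support x))"

lemma even_subsets_finite: "A \<in> even_subsets n \<Longrightarrow> finite A"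
  by (auto simp: even_subsets_def intro: finite_subset)

lemma sym_diff_even_subsets:
  assumes "A \<in> even_subsets n" "B \<in> even_subsets n"
  shows "sym_diff A B \<in> even_subsets n"
  using assms even_card_sym_diff[OF assms[THEN even_subsets_finite]]
  by (auto simp: even_subsets_def)

text \<open>The inverse \<open>word n\<close> forgets whether n belongs to the set. Nothing is lost:
  n belongs to an even-sized set exactly when the rest of the set has odd size.\<close>

lemma bij_betw_parity_code: "bij_betw (parity_code n) {x. length x = n} (even_subsets n)"
proof (rule bij_betwI[where g = "word n"])
  have n: "n \<notin> support x" if "length x = n" for x
    using support_subset[OF that] by auto
  show "parity_code n \<in> {x. length x = n} \<rightarrow> even_subsets n"
  proof
    fix x :: "bool list" assume "x \<in> {x. length x = n}"
    with n[of x] support_subset[of x n] show "parity_code n x \<in> even_subsets n"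
      by (auto simp: parity_code_def even_subsets_def)
  qed
  show "word n \<in> even_subsets n \<rightarrow> {x. length x = n}" by simp
  show "word n (parity_code n x) = x" if "x \<in> {x. length x = n}" for x
    using that by (intro nth_equalityI) (auto simp: word_def parity_code_def support_def)
  show "parity_code n (word n A) = A" if A: "A \<in> even_subsets n" for A
  proof -
    have fin: "finite A" and sub: "A \<subseteq> {..n}" and ev: "even (card A)"
      using A even_subsets_finite[OF A] by (simp_all add: even_subsets_def)
    have supp: "support (word n A) = A - {n}"
      using sub by (auto simp: support_def word_def)
    show ?thesis
    proof (cases "n \<in> A")
      case True
      then have "Suc (card (A - {n})) = card A" by (rule card_Suc_Diff1[OF fin])
      with ev have "odd (card (A - {n}))" by presburger
      with True supp show ?thesis by (auto simp: parity_code_def)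
    next
      case False
      with supp ev show ?thesis by (simp add: parity_code_def)
    qed
  qed
qed

text \<open>The parity bits of \<open>x\<close> and \<open>y\<close> differ exactly when their
  Hamming distance is odd, so adding them rounds that distance up to an even number. The result is
  twice the distance in the square.\<close>

lemma card_sym_diff_parity_code:
  assumes "length x = n" "length y = n"
  shows "card (sym_diff (parity_code n x) (parity_code n y)) = 2 * ((hamming x y + 1) div 2)"
proof -
  let ?D = "sym_diff (support x) (support y)"
  have n: "n \<notin> support x" "n \<notin> support y"
    using assms[THEN support_subset] by auto
  have ev: "even (card ?D) \<longleftrightarrow> (even (card (support x)) \<longleftrightarrow> even (card (support y)))"
    by (simp add: even_card_sym_diff)
  show ?thesis
  proof (cases "even (card ?D)")
    case True
    then have "sym_diff (parity_code n x) (parity_code n y) = ?D"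
      using n ev by (auto simp: parity_code_def)
    with True show ?thesis by (simp add: hamming_def)
  next
    case False
    then have "sym_diff (parity_code n x) (parity_code n y) = insert n ?D"
      using n ev by (auto simp: parity_code_def)
    then have "card (sym_diff (parity_code n x) (parity_code n y)) = Suc (card ?D)"
      using n by simp
    with False show ?thesis unfolding hamming_def by presburger
  qed
qed

section \<open>Automorphisms and distance-transitivity\<close>

text \<open>A Hamming distance of 1 or 2 means that the codes differ in exactly two elements, so a
  bijection preserving the sizes of all symmetric differences preserves adjacency in both
  directions.\<close>

lemma automorphism_square_hypercubeI:
  assumes bij: "bij_betw f {x. length x = n} {x. length x = n}"
    and card: "\<And>x y. length x = n \<Longrightarrow> length y = n \<Longrightarrow>
      card (sym_diff (parity_code n (f x)) (parity_code n (f y))) =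
      card (sym_diff (parity_code n x) (parity_code n y))"
  shows "automorphism (square (hypercube n)) f"
proof -
  have arc: "(x, y) \<in> parcs (square (hypercube n)) \<longleftrightarrow>
      card (sym_diff (parity_code n x) (parity_code n y)) = 2"
    if "length x = n" "length y = n" for x y
    using that unfolding parcs_square_hypercube_iff card_sym_diff_parity_code[OF that]
    by (simp, presburger)
  have len: "length (f x) = n" if "length x = n" for x
    using bij_betwE[OF bij] that by simp
  show ?thesis
    unfolding automorphism_iff[OF pair_graph_square[OF pair_graph_hypercube]]
    using bij by (simp add: arc len card)
qed

theorem theorem3p3:
  fixes n :: nat
  assumes "n \<ge> 4"
  shows "distance_transitive (square (hypercube n))"
proof -
  let ?V = "{x :: bool list. length x = n}" and ?c = "parity_code n" and ?E = "even_subsets n"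
  note c = bij_betw_parity_code[of n]
  have "\<exists>f. automorphism (square (hypercube n)) f \<and> f u = x \<and> f v = y"
    if len: "length u = n" "length v = n" "length x = n" "length y = n"
      and d: "gdist (square (hypercube n)) u v = gdist (square (hypercube n)) x y" for u v x y
  proof -
    have cE: "?c w \<in> ?E" if "length w = n" for w using c that by (auto dest: bij_betwE)
    have "card (sym_diff (?c u) (?c v)) = card (sym_diff (?c x) (?c y))"
      using d len by (simp add: gdist_square_hypercube card_sym_diff_parity_code)
    moreover have "sym_diff (?c u) (?c v) \<subseteq> {..n}" "sym_diff (?c x) (?c y) \<subseteq> {..n}"
      using len cE sym_diff_even_subsets unfolding even_subsets_def by blast+
    ultimately obtain p where p: "bij_betw p {..n} {..n}"
        "p ` sym_diff (?c u) (?c v) = sym_diff (?c x) (?c y)"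
      using permutation_mapping_subset[of "{..n}"] by (metis finite_atMost)
    then have inj: "inj_on p {..n}" by (simp add: bij_betw_def)
    \<comment> \<open>Translate the code of \<open>u\<close> to the empty set, permute by
      \<open>p\<close>, then translate the empty set to the code of \<open>x\<close>.\<close>
    define F where "F A = sym_diff (p ` sym_diff A (?c u)) (?c x)" for A
    have pE: "p ` A \<in> ?E" if "A \<in> ?E" for A
      using that p(1) card_image[OF inj_on_subset[OF inj], of A]
      unfolding even_subsets_def bij_betw_def by auto
    have FE: "F A \<in> ?E" if "A \<in> ?E" for A
      unfolding F_def by (intro sym_diff_even_subsets pE that cE len)
    \<comment> \<open>Images under the injective \<open>p\<close> commute with symmetric
      differences, and both translations cancel.\<close>
    have Fdiff: "sym_diff (F A) (F B) = p ` sym_diff A B" if "A \<in> ?E" "B \<in> ?E" for A B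
    proof -
      have sub: "A \<subseteq> {..n}" "B \<subseteq> {..n}" "?c u \<subseteq> {..n}"
        using that cE[OF len(1)] by (auto simp: even_subsets_def)
      have sd: "p ` sym_diff X Y = sym_diff (p ` X) (p ` Y)" if "X \<subseteq> {..n}" "Y \<subseteq> {..n}" for X Y
      proof -
        have "X - Y \<subseteq> {..n}" "Y - X \<subseteq> {..n}" using that by auto
        then show ?thesis
          using that by (simp only: image_Un inj_on_image_set_diff[OF inj])
      qed
      note sd = sd[OF sub(1,3)] sd[OF sub(2,3)] sd[OF sub(1,2)]
      show ?thesis unfolding F_def sd by blast
    qed
    \<comment> \<open>If \<open>F A = F B\<close>, the image under \<open>p\<close> of the symmetric
      difference of \<open>A\<close> and \<open>B\<close> is empty. Surjectivity then follows
      because \<open>?E\<close> is finite and mapped into itself.\<close>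
    have "inj_on F ?E"
    proof (rule inj_onI)
      fix A B assume AB: "A \<in> ?E" "B \<in> ?E" "F A = F B"
      with Fdiff[OF AB(1,2)] have "p ` sym_diff A B = {}" by simp
      then show "A = B" by auto
    qed
    moreover have "finite ?E" by (simp add: even_subsets_def)
    ultimately have F: "bij_betw F ?E ?E"
      using FE by (simp add: bij_betw_def endo_inj_surj image_subsetI)
    \<comment> \<open>Conjugation by the parity code carries \<open>F\<close> back to words.\<close>
    define f where "f = inv_into ?V ?c \<circ> (F \<circ> ?c)"
    have f: "bij_betw f ?V ?V"
      unfolding f_def
      by (rule bij_betw_trans[OF bij_betw_trans[OF c F] bij_betw_inv_into[OF c]])
    have cf: "?c (f w) = F (?c w)" if "length w = n" for w
      unfolding f_def using FE[OF cE[OF that]] bij_betw_inv_into_right[OF c] by simp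
    have "automorphism (square (hypercube n)) f"
    proof (rule automorphism_square_hypercubeI[OF f])
      fix a b :: "bool list" assume ab: "length a = n" "length b = n"
      have "sym_diff (?c a) (?c b) \<subseteq> {..n}"
        using sym_diff_even_subsets[OF cE[OF ab(1)] cE[OF ab(2)]] by (simp add: even_subsets_def)
      then show "card (sym_diff (?c (f a)) (?c (f b))) = card (sym_diff (?c a) (?c b))"
        unfolding cf[OF ab(1)] cf[OF ab(2)] Fdiff[OF cE[OF ab(1)] cE[OF ab(2)]]
        by (intro card_image inj_on_subset[OF inj])
    qed
    \<comment> \<open>As the code is injective, the images of \<open>u\<close> and \<open>v\<close>
      can be checked on codes.\<close>
    moreover have "f w = z" if "length w = n" "length z = n" "F (?c w) = ?c z" for w z
    proof -
      have "length (f w) = n" using bij_betwE[OF f] that by simp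
      then show ?thesis
        using that cf[of w] bij_betw_imp_inj_on[OF c] by (auto dest: inj_onD)
    qed
    moreover have "F (?c u) = ?c x" by (simp add: F_def)
    moreover have "F (?c v) = ?c y"
    proof -
      \<comment> \<open>By the choice of \<open>p\<close>, this set is sent to the symmetric
        difference of \<open>?c x\<close> and \<open>?c y\<close>; adding \<open>?c x\<close> leaves
        \<open>?c y\<close>.\<close>
      have "sym_diff (?c v) (?c u) = sym_diff (?c u) (?c v)" by auto
      then have "F (?c v) = sym_diff (sym_diff (?c x) (?c y)) (?c x)"
        unfolding F_def using p(2) by simp
      then show ?thesis by auto
    qed
    ultimately show ?thesis using len by blast
  qed
  then show ?thesis
    unfolding distance_transitive_def
    by (simp add: pair_graph_square pair_graph_hypercube)
qed

end
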